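(* Let $\ell,u\ge1$ be integers, put $S_{\ell,u}=\{-\ell,\dots,-1,1,\dots,u\}$, and let $\mathcal B^{(n)}_{\ell,u}$ be the space of $n\times n$ complex matrices $B=(b_{ij})$ with $b_{ij}=0$ unless $j-i\in S_{\ell,u}$. There exists, for every $n\ge0$, a multiplier matrix $C_n=(c^{(n)}_{ij})$ with nonzero complex entries on the support $j-i\in S_{\ell,u}$ such that $$\operatorname{perm}B=\det(C_n\circ B)\qquad\text{for every }B\in\mathcal B^{(n)}_{\ell,u}$$ if and only if $$\min(\ell,u)=1\qquad\text{or}\qquad(\ell,u)=(2,2).$$ In every positive case the multipliers may be chosen in $\{\pm1\}$ by a rule independent of $n$.
   Context: $\operatorname{perm}$ denotes the permanent and $\circ$ the Hadamard (entrywise) product. *)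

theory Defs
  imports Complex_Main "Jordan_Normal_Form.Determinant"
begin

definition permanent :: "'a :: comm_semiring_1 mat \<Rightarrow> 'a" where
  "permanent A = (\<Sum>p | p permutes {0..<dim_row A}. \<Prod>i = 0..<dim_row A. A $$ (i, p i))"

definition hadamard :: "'a :: times mat \<Rightarrow> 'a mat \<Rightarrow> 'a mat" where
  "hadamard A B = mat (dim_row A) (dim_col A) (\<lambda>(i, j). A $$ (i, j) * B $$ (i, j))"

definition offsets :: "nat \<Rightarrow> nat \<Rightarrow> int set" where
  "offsets l u = {- int l..-1} \<union> {1..int u}"

text \<open>Matrices are indexed from 0 here; the difference of column and row index does not
  depend on this choice.\<close>

definition band_matrices :: "nat \<Rightarrow> nat \<Rightarrow> nat \<Rightarrow> complex mat set" where
  "band_matrices l u n =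
     {B \<in> carrier_mat n n. \<forall>i<n. \<forall>j<n. int j - int i \<notin> offsets l u \<longrightarrow> B $$ (i, j) = 0}"

text \<open>The entries of a multiplier off the support are unconstrained; they are irrelevant, being
  multiplied by 0.\<close>

definition is_multiplier :: "nat \<Rightarrow> nat \<Rightarrow> nat \<Rightarrow> complex mat \<Rightarrow> bool" where
  "is_multiplier l u n C \<longleftrightarrow>
     C \<in> carrier_mat n n \<and>
     (\<forall>i<n. \<forall>j<n. int j - int i \<in> offsets l u \<longrightarrow> C $$ (i, j) \<noteq> 0) \<and>
     (\<forall>B \<in> band_matrices l u n. permanent B = det (hadamard C B))"

end

theory Submission
  imports Defs
begin

text \<open>Testing on permutation matrices shows that C is a multiplier iff for every permutation p
  supported on the band, the product of the entries of C along p is the sign of p.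

  For l = 1 and for l = u = 2 one may take -1 on the first subdiagonal and 1 elsewhere: deleting
  the last index from its cycle (or, in the pentadiagonal case, when this would create a fixed
  point, deleting the final block of two or four indices) preserves the
  property that the sign of p is -1 to the number of steps i \<mapsto> i - 1.

  If l \<ge> 2 and u \<ge> 3, there are six permutations of six points supported on the band, three of
  which use together the same positions as the other three; but exactly one of the six is odd.
  Transposition exchanges l and u.\<close>

section \<open>Band supports and transposition\<close>

definition band_perms :: "nat \<Rightarrow> nat \<Rightarrow> nat \<Rightarrow> (nat \<Rightarrow> nat) set" where
  "band_perms l u n = {p. p permutes {0..<n} \<and> (\<forall>i<n. int (p i) - int i \<in> offsets l u)}"

text \<open>Written with sums of naturals only, the support condition suits linear arithmetic and
  shows that exchanging \<open>a\<close> and \<open>b\<close> amounts to exchanging \<open>l\<close>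
  and \<open>u\<close>.\<close>

lemma offsets_iff: "int b - int a \<in> offsets l u \<longleftrightarrow> a \<noteq> b \<and> a \<le> b + l \<and> b \<le> a + u"
  unfolding offsets_def by auto

lemma permanent_transpose:
  assumes "A \<in> carrier_mat n n"
  shows "permanent (transpose_mat A) = permanent A"
proof -
  have "permanent (transpose_mat A) = (\<Sum>p | p permutes {0..<n}. \<Prod>i = 0..<n. A $$ (p i, i))"
    using assms unfolding permanent_def by (intro sum.cong prod.cong refl) auto
  also have "\<dots> = (\<Sum>p | p permutes {0..<n}. \<Prod>i = 0..<n. A $$ (Hilbert_Choice.inv p i, i))"
    by (rule sum_permutations_inverse)
  also have "\<dots> = (\<Sum>p | p permutes {0..<n}. \<Prod>i = 0..<n. A $$ (i, p i))"
  proof (intro sum.cong refl)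
    fix p assume "p \<in> {p. p permutes {0..<n}}"
    then have p: "p permutes {0..<n}" by simp
    have "(\<Prod>i = 0..<n. A $$ (Hilbert_Choice.inv p i, i)) = (\<Prod>i = 0..<n. A $$ (Hilbert_Choice.inv p (p i), p i))"
      using p by (rule prod.permute[unfolded comp_def])
    then show "(\<Prod>i = 0..<n. A $$ (Hilbert_Choice.inv p i, i)) = (\<Prod>i = 0..<n. A $$ (i, p i))"
      by (simp add: permutes_inverses[OF p])
  qed
  finally show ?thesis
    using assms unfolding permanent_def by simp
qed

text \<open>Hadamard products commute with transposition, and \<open>permanent\<close> and
  \<open>det\<close> are both invariant under it. This later reduces \<open>u = 1\<close> to
  \<open>l = 1\<close>, and the obstruction for \<open>l \<ge> 3\<close> to the one for
  \<open>u \<ge> 3\<close>.\<close>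

lemma is_multiplier_transpose:
  assumes "is_multiplier l u n C"
  shows "is_multiplier u l n (transpose_mat C)"
proof -
  have C: "C \<in> carrier_mat n n"
    using assms unfolding is_multiplier_def by simp
  have "permanent B = det (hadamard (transpose_mat C) B)" if B: "B \<in> band_matrices u l n" for B
  proof -
    have Bn: "B \<in> carrier_mat n n"
      using B unfolding band_matrices_def by simp
    have "transpose_mat B \<in> band_matrices l u n"
      using B unfolding band_matrices_def offsets_iff by fastforce
    then have "permanent (transpose_mat B) = det (hadamard C (transpose_mat B))"
      using assms unfolding is_multiplier_def by blast
    moreover have "hadamard C (transpose_mat B) = transpose_mat (hadamard (transpose_mat C) B)"
      using C Bn unfolding hadamard_def by (intro eq_matI) auto
    moreover have "hadamard (transpose_mat C) B \<in> carrier_mat n n"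
      using C unfolding hadamard_def by simp
    ultimately show ?thesis
      using permanent_transpose[OF Bn] det_transpose by metis
  qed
  then show ?thesis
    using assms C unfolding is_multiplier_def offsets_iff by auto
qed

section \<open>Multipliers as a sign condition on band permutations\<close>

lemma is_multiplierI:
  assumes C: "C \<in> carrier_mat n n"
    and nz: "\<And>i j. i < n \<Longrightarrow> j < n \<Longrightarrow> int j - int i \<in> offsets l u \<Longrightarrow> C $$ (i, j) \<noteq> 0"
    and one: "\<And>p. p \<in> band_perms l u n \<Longrightarrow> of_int (sign p) * (\<Prod>i = 0..<n. C $$ (i, p i)) = 1"
  shows "is_multiplier l u n C"
proof -
  have "permanent B = det (hadamard C B)" if B: "B \<in> band_matrices l u n" for B
  proof -
    have Bn: "B \<in> carrier_mat n n"
      using B unfolding band_matrices_def by simp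
    have H: "hadamard C B \<in> carrier_mat n n"
      using C unfolding hadamard_def by simp
    \<comment> \<open>The two expansions agree term by term: for a band permutation the extra factor
      is 1 by \<open>one\<close>, and for any other permutation \<open>B\<close> has a zero along
      it, so both terms vanish.\<close>
    have "(\<Prod>i = 0..<n. B $$ (i, p i)) =
        of_int (sign p) * (\<Prod>i = 0..<n. hadamard C B $$ (i, p i))"
      if p: "p permutes {0..<n}" for p
    proof -
      have lt: "p i < n" if "i < n" for i
        using p that permutes_in_image[OF p, of i] by simp
      have H_prod: "(\<Prod>i = 0..<n. hadamard C B $$ (i, p i)) =
          (\<Prod>i = 0..<n. C $$ (i, p i)) * (\<Prod>i = 0..<n. B $$ (i, p i))"
        unfolding prod.distrib[symmetric] using C lt
        by (intro prod.cong) (auto simp: hadamard_def)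
      show ?thesis
      proof (cases "p \<in> band_perms l u n")
        case True
        then show ?thesis
          using one[OF True] unfolding H_prod by (simp add: mult.assoc[symmetric])
      next
        case False
        then obtain i where "i < n" "int (p i) - int i \<notin> offsets l u"
          using p unfolding band_perms_def by blast
        then have "(\<Prod>i = 0..<n. B $$ (i, p i)) = 0"
          using B lt unfolding band_matrices_def by (intro prod_zero bexI[of _ i]) auto
        then show ?thesis
          unfolding H_prod by simp
      qed
    qed
    then show ?thesis
      using Bn unfolding permanent_def det_def'[OF H] by (auto intro!: sum.cong)
  qed
  then show ?thesis
    using C nz unfolding is_multiplier_def by blast
qed

text \<open>For \<open>B\<close> the permutation matrix of \<open>p\<close>, only the term of
  \<open>p\<close> survives in either expansion: it is 1 in the permanent and the left-hand side
  here in the determinant.\<close>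

lemma is_multiplierD:
  assumes M: "is_multiplier l u n C" and p: "p \<in> band_perms l u n"
  shows "of_int (sign p) * (\<Prod>i = 0..<n. C $$ (i, p i)) = 1"
proof -
  have pp: "p permutes {0..<n}"
    using p unfolding band_perms_def by simp
  have C: "C \<in> carrier_mat n n"
    using M unfolding is_multiplier_def by simp
  define B :: "complex mat" where "B = mat n n (\<lambda>(i, j). if j = p i then 1 else 0)"
  have Bn: "B \<in> carrier_mat n n"
    unfolding B_def by simp
  have H: "hadamard C B \<in> carrier_mat n n"
    using C unfolding hadamard_def by simp
  have lt: "q i < n" if "q permutes {0..<n}" "i < n" for q i
    using that permutes_in_image[OF that(1), of i] by simp
  have zero: "\<exists>i<n. q i \<noteq> p i" if "q permutes {0..<n}" "q \<noteq> p" for q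
  proof (rule ccontr)
    assume "\<not> ?thesis"
    then have "q i = p i" for i
      using permutes_not_in[OF that(1), of i] permutes_not_in[OF pp, of i] by (cases "i < n") auto
    then show False
      using that(2) by auto
  qed
  have "B \<in> band_matrices l u n"
    using p unfolding band_matrices_def band_perms_def B_def by auto
  then have "permanent B = det (hadamard C B)"
    using M unfolding is_multiplier_def by blast
  moreover have "permanent B = (\<Sum>q | q permutes {0..<n}. if q = p then 1 else 0)"
    unfolding permanent_def using Bn
  proof (intro sum.cong, goal_cases)
    case (2 q)
    then have q: "q permutes {0..<n}" by simp
    show ?case
      using zero[OF q] lt[OF q] Bn
      by (cases "q = p") (auto simp: B_def Bex_def intro!: prod_zero prod.neutral)
  qed auto
  moreover have "det (hadamard C B) = (\<Sum>q | q permutes {0..<n}.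
      if q = p then of_int (sign p) * (\<Prod>i = 0..<n. C $$ (i, p i)) else 0)"
    unfolding det_def'[OF H]
  proof (intro sum.cong, goal_cases)
    case (2 q)
    then have q: "q permutes {0..<n}" by simp
    show ?case
    proof (cases "q = p")
      case True
      then show ?thesis
        using lt[OF q] C by (auto simp: B_def hadamard_def intro!: prod.cong)
    next
      case False
      then have "(\<Prod>i = 0..<n. hadamard C B $$ (i, q i)) = 0"
        using zero[OF q] lt[OF q] C by (intro prod_zero) (auto simp: B_def hadamard_def Bex_def)
      then show ?thesis
        using False by simp
    qed
  qed auto
  ultimately show ?thesis
    using pp by (simp add: finite_permutations)
qed

section \<open>Signs of band permutations by counting down-steps\<close>

text \<open>A down-step is an index sent to its predecessor. Testing \<open>Suc (p i) = i\<close>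
  avoids truncated subtraction, under which a fixed 0 would count.\<close>

definition down_sign :: "nat \<Rightarrow> (nat \<Rightarrow> nat) \<Rightarrow> int" where
  "down_sign n p = (\<Prod>i = 0..<n. if Suc (p i) = i then -1 else 1)"

lemma down_sign_0: "down_sign 0 p = 1"
  by (simp add: down_sign_def)

lemma down_sign_Suc: "down_sign (Suc n) p = down_sign n p * (if Suc (p n) = n then -1 else 1)"
  by (simp add: down_sign_def)

lemma down_sign_cong:
  "(\<And>i. i < n \<Longrightarrow> Suc (p i) = i \<longleftrightarrow> Suc (q i) = i) \<Longrightarrow> down_sign n p = down_sign n q"
  unfolding down_sign_def by (intro prod.cong) auto

lemma permutes_peel:
  fixes p :: "nat \<Rightarrow> nat"
  assumes "p permutes {0..<Suc n}" and "p n = n"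
  shows "p permutes {0..<n}"
  using assms by (auto intro: permutes_superset simp: less_Suc_eq)

lemma sign_transpose_comp:
  fixes p :: "nat \<Rightarrow> nat"
  assumes "p permutes {0..<n}" and "a \<noteq> b"
  shows "sign (transpose a b \<circ> p) = - sign p"
proof -
  have "permutation p"
    using assms(1) by (auto intro: permutation_permutes[THEN iffD2])
  then show ?thesis
    using assms(2) by (simp add: sign_compose permutation_swap_id sign_swap_id)
qed

lemma transpose_comp_permutes:
  fixes p :: "nat \<Rightarrow> nat"
  assumes "p permutes {0..<n}" and "a < n" and "b < n"
  shows "transpose a b \<circ> p permutes {0..<n}"
  using assms by (intro permutes_compose permutes_swap_id) auto

text \<open>If the last index \<open>n\<close> is not fixed, it is a down-step. Deleting it from its
  cycle flips the sign and loses this down-step. No new one arises, since the preimage of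
  \<open>n\<close> is now sent to \<open>n - 1\<close>, which is not below it.\<close>

lemma sign_eq_down_sign_hessenberg:
  assumes "p permutes {0..<n}" and "\<And>i. i < n \<Longrightarrow> i \<le> Suc (p i)"
  shows "sign p = down_sign n p"
  using assms
proof (induction n arbitrary: p)
  case 0
  then show ?case
    by (simp add: down_sign_0)
next
  case (Suc n)
  note inj = permutes_inj[OF Suc.prems(1), THEN injD]
  have ub: "p i \<le> n" if "i \<le> n" for i
    using that permutes_in_image[OF Suc.prems(1), of i] by simp
  show ?case
  proof (cases "p n = n")
    case True
    then have "p permutes {0..<n}"
      using Suc.prems(1) by (rule permutes_peel[rotated])
    then have "sign p = down_sign n p"
      using Suc.IH Suc.prems(2) by simp
    then show ?thesis
      using True by (simp add: down_sign_Suc)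
  next
    case False
    then have n: "n = Suc (p n)"
      using Suc.prems(2)[of n] ub[of n] by simp
    \<comment> \<open>Composing with this transposition on the left fixes \<open>n\<close> and sends
      its former preimage to \<open>p n\<close>.\<close>
    define q where "q = transpose (p n) n \<circ> p"
    have q_eq: "q i = (if p i = n then p n else p i)" if "i < n" for i
      using inj[of i n] that by (auto simp: q_def transpose_def)
    have "q permutes {0..<n}"
      unfolding q_def by (rule permutes_peel[OF transpose_comp_permutes])
        (use Suc.prems(1) ub[of n] in auto)
    moreover have "i \<le> Suc (q i)" if "i < n" for i
      using Suc.prems(2)[of i] n that unfolding q_eq[OF that] by auto
    ultimately have "sign q = down_sign n q"
      by (rule Suc.IH)
    also have "\<dots> = down_sign n p"
      using n by (intro down_sign_cong) (auto simp: q_eq)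
    finally show ?thesis
      using n sign_transpose_comp[OF Suc.prems(1) False, folded q_def] by (simp add: down_sign_Suc)
  qed
qed

text \<open>Fixed points must be excluded: exchanging \<open>k\<close> and \<open>k + 2\<close>
  while fixing \<open>k + 1\<close> is odd without any down-step. So the induction may delete the
  last index only when its image and preimage differ.\<close>

lemma sign_eq_down_sign_pentadiagonal:
  assumes "p permutes {0..<n}" and "\<And>i. i < n \<Longrightarrow> p i \<noteq> i \<and> i \<le> p i + 2 \<and> p i \<le> i + 2"
  shows "sign p = down_sign n p"
  using assms
proof (induction n arbitrary: p rule: less_induct)
  case (less n)
  note perm = less.prems(1) and band = less.prems(2)
  note inj = permutes_inj[OF perm, THEN injD]
  have ub: "p i < n" if "i < n" for i
    using that permutes_in_image[OF perm, of i] by simp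
  show ?case
  proof (cases n)
    case 0
    then show ?thesis
      using perm by (simp add: down_sign_0)
  next
    case (Suc m)
    obtain a where a: "p a = m" "a < n"
      using permutes_image[OF perm] Suc by (metis atLeastLessThan_iff imageE lessI zero_le)
    have pm: "m = Suc (p m) \<or> m = p m + 2"
      using band[of m] ub[of m] Suc by force
    have am: "m = Suc a \<or> m = a + 2"
      using band[of a] a Suc by force
    \<comment> \<open>Image and preimage of the last index \<open>m\<close> each lie one or two
      below it. They coincide in A and B, where a whole block is removed; they differ in C and D,
      where \<open>m\<close> alone is deleted.\<close>
    consider (A) k where "m = Suc k" "p m = k" "p k = m"
      | (B) k where "m = k + 2" "p m = k" "p k = m"
      | (C) k where "m = k + 2" "p m = Suc k" "p k = m"
      | (D) k where "m = k + 2" "p m = k" "p (Suc k) = m"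
      using pm am a by auto
    then show ?thesis
    proof cases
      case A
      \<comment> \<open>The removed 2-cycle is odd and has exactly one down-step, from
        \<open>m\<close> to \<open>k\<close>.\<close>
      define q where "q = transpose k m \<circ> p"
      have q_eq: "q i = p i" if "i < k" for i
        using inj[of i m] inj[of i k] A that by (auto simp: q_def transpose_def)
      have "q permutes {0..<k}"
        unfolding q_def by (rule permutes_peel[OF permutes_peel[OF transpose_comp_permutes]])
          (use perm A Suc in auto)
      then have "sign q = down_sign k q"
        using band A Suc by (intro less.IH) (auto simp: q_eq)
      also have "\<dots> = down_sign k p"
        by (intro down_sign_cong) (auto simp: q_eq)
      finally show ?thesis
        using A Suc sign_transpose_comp[OF perm, of k m, folded q_def] by (simp add: down_sign_Suc)
    next
      case B
      have lt: "Suc k < n" "k < n" "m < n"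
        using B Suc by auto
      \<comment> \<open>With \<open>k\<close> and \<open>m\<close> exchanged, the band leaves only
        \<open>k - 1\<close> as image and as preimage of \<open>Suc k\<close>. The last four indices
        thus form two interlaced 2-cycles, an even block without down-steps.\<close>
      have "p (Suc k) \<noteq> m" "p (Suc k) \<noteq> k"
        using inj[of "Suc k" m] inj[of "Suc k" k] B by auto
      then have pk: "k = Suc (p (Suc k))"
        using band[OF lt(1)] ub[OF lt(1)] B Suc by force
      define j where "j = p (Suc k)"
      obtain b where b: "p b = Suc k" "b < n"
        using permutes_image[OF perm] lt(1) by (metis atLeastLessThan_iff imageE zero_le)
      have "b \<noteq> k" "b \<noteq> m"
        using b B by auto
      then have "b = j"
        using band[OF b(2)] b B Suc pk j_def by force
      then have kj: "k = Suc j" "p (Suc k) = j" "p j = Suc k"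
        using pk b j_def by auto
      define r where "r = transpose k m \<circ> p"
      define q where "q = transpose j (Suc k) \<circ> r"
      have r: "r permutes {0..<n}"
        unfolding r_def using perm lt by (intro transpose_comp_permutes) auto
      have q_eq: "q i = p i" if "i < j" for i
        using inj[of i m] inj[of i k] inj[of i j] inj[of i "Suc k"] B kj that
        by (auto simp: q_def r_def transpose_def)
      have "q permutes {0..<j}"
        unfolding q_def by (rule permutes_peel[OF permutes_peel[OF permutes_peel[OF permutes_peel[OF
                transpose_comp_permutes]]]])
          (use r B Suc kj in \<open>auto simp: r_def transpose_def\<close>)
      then have "sign q = down_sign j q"
        using band kj lt by (intro less.IH) (auto simp: q_eq)
      also have "\<dots> = down_sign j p"
        by (intro down_sign_cong) (auto simp: q_eq)
      finally show ?thesis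
        using B Suc kj sign_transpose_comp[OF perm, of k m, folded r_def]
          sign_transpose_comp[OF r, of j "Suc k", folded q_def]
        by (simp add: down_sign_Suc)
    next
      case C
      \<comment> \<open>The down-step from \<open>m\<close> to \<open>Suc k\<close> disappears, and
        the new step from \<open>k\<close> to \<open>Suc k\<close> goes up, so the parity changes
        along with the sign.\<close>
      define q where "q = transpose (Suc k) m \<circ> p"
      have q_eq: "q i = (if i = k then Suc k else p i)" if "i < m" for i
        using inj[of i m] inj[of i k] C that by (auto simp: q_def transpose_def)
      have "q permutes {0..<m}"
        unfolding q_def by (rule permutes_peel[OF transpose_comp_permutes]) (use perm C Suc in auto)
      then have "sign q = down_sign m q"
        using band C Suc by (intro less.IH) (auto simp: q_eq)
      also have "\<dots> = down_sign m p"
        using C by (intro down_sign_cong) (auto simp: q_eq)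
      finally show ?thesis
        using C Suc sign_transpose_comp[OF perm, of "Suc k" m, folded q_def] by (simp add: down_sign_Suc)
    next
      case D
      \<comment> \<open>Here a down-step is gained instead: \<open>m\<close> descended by two, while
        \<open>q\<close> sends \<open>Suc k\<close> to \<open>k\<close>.\<close>
      define q where "q = transpose k m \<circ> p"
      have q_eq: "q i = (if i = Suc k then k else p i)" if "i < m" for i
        using inj[of i m] inj[of i "Suc k"] D that by (auto simp: q_def transpose_def)
      have "q permutes {0..<m}"
        unfolding q_def by (rule permutes_peel[OF transpose_comp_permutes]) (use perm D Suc in auto)
      then have "sign q = down_sign m q"
        using band D Suc by (intro less.IH) (auto simp: q_eq)
      also have "\<dots> = - down_sign (Suc k) q"
        using D by (simp add: down_sign_Suc q_eq)
      also have "down_sign (Suc k) q = down_sign (Suc k) p"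
        using D by (intro down_sign_cong) (auto simp: q_eq)
      finally show ?thesis
        using D Suc sign_transpose_comp[OF perm, of k m, folded q_def] by (simp add: down_sign_Suc)
    qed
  qed
qed

section \<open>The multiplier in the positive cases\<close>

definition subdiag_sign :: "nat \<Rightarrow> nat \<Rightarrow> complex" where
  "subdiag_sign i j = (if Suc j = i then -1 else 1)"

text \<open>The product of the entries along \<open>p\<close> is \<open>down_sign n p\<close>, which
  equals \<open>sign p\<close>; multiplied by \<open>sign p\<close> it gives 1.\<close>

lemma is_multiplier_subdiag_sign:
  assumes "l = 1 \<or> l = 2 \<and> u = 2"
  shows "is_multiplier l u n (mat n n (\<lambda>(i, j). subdiag_sign i j))"
proof (rule is_multiplierI)
  fix p assume p: "p \<in> band_perms l u n"
  then have perm: "p permutes {0..<n}"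
    unfolding band_perms_def by simp
  have "sign p = down_sign n p"
    using assms
  proof
    assume "l = 1"
    then show ?thesis
      using p unfolding band_perms_def offsets_iff
      by (intro sign_eq_down_sign_hessenberg) auto
  next
    assume "l = 2 \<and> u = 2"
    then show ?thesis
      using p unfolding band_perms_def offsets_iff
      by (intro sign_eq_down_sign_pentadiagonal) auto
  qed
  moreover have "(\<Prod>i = 0..<n. mat n n (\<lambda>(i, j). subdiag_sign i j) $$ (i, p i)) =
      of_int (down_sign n p)"
    unfolding down_sign_def of_int_prod using permutes_in_image[OF perm]
    by (intro prod.cong) (auto simp: subdiag_sign_def)
  ultimately show "of_int (sign p) *
      (\<Prod>i = 0..<n. mat n n (\<lambda>(i, j). subdiag_sign i j) $$ (i, p i)) = 1"
    by (metis of_int_1 of_int_mult sign_idempotent)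
qed (auto simp: subdiag_sign_def)

section \<open>The obstruction in size six\<close>

lemma not_is_multiplier_6:
  assumes "2 \<le> l" and "3 \<le> u"
  shows "\<not> is_multiplier l u 6 C"
proof
  assume M: "is_multiplier l u 6 C"
  \<comment> \<open>The narrower band with offsets from -2 to 3 lies in every band considered, so
    the same six permutations serve for all \<open>l\<close> and \<open>u\<close>.\<close>
  have along: "of_int (sign p) * (C $$ (0, p 0) * C $$ (1, p 1) * C $$ (2, p 2) * C $$ (3, p 3) *
      C $$ (4, p 4) * C $$ (5, p 5)) = 1"
    if perm: "p permutes {0..<6}"
      and band: "\<forall>i\<in>{0,1,2,3,4,5}. i \<noteq> p i \<and> i \<le> p i + 2 \<and> p i \<le> i + 3" for p
  proof -
    have eq: "{0..<6} = {0,1,2,3,4,5::nat}"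
      by auto
    have "i \<noteq> p i \<and> i \<le> p i + l \<and> p i \<le> i + u" if "i < 6" for i
    proof -
      have "i \<in> {0,1,2,3,4,5}"
        using that by auto
      then have "i \<noteq> p i \<and> i \<le> p i + 2 \<and> p i \<le> i + 3"
        using band by blast
      then show ?thesis
        using assms by linarith
    qed
    then have "p \<in> band_perms l u 6"
      using perm unfolding band_perms_def offsets_iff by auto
    from is_multiplierD[OF M this] show ?thesis
      unfolding eq by (simp add: mult.assoc)
  qed
  note perm_simps = permutes_compose permutes_swap_id sign_compose permutation_compose
    permutation_swap_id sign_swap_id transpose_def
  \<comment> \<open>A chain of transpositions of \<open>a b\<close>, \<open>b c\<close>,
    \<open>c d\<close> composes to the cycle sending \<open>a\<close> to \<open>b\<close>,
    \<open>b\<close> to \<open>c\<close>, \<open>c\<close> to \<open>d\<close> and \<open>d\<close>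
    to \<open>a\<close>.\<close>
  have e1: "C $$ (0, 1) * C $$ (1, 0) * C $$ (2, 5) * C $$ (3, 4) * C $$ (4, 2) * C $$ (5, 3) = 1"
    using along[of "transpose 0 1 \<circ> transpose 2 5 \<circ> transpose 5 3 \<circ> transpose 3 4"]
    by (simp add: perm_simps minus_equation_iff)
  have e2: "C $$ (0, 1) * C $$ (1, 3) * C $$ (2, 0) * C $$ (3, 2) * C $$ (4, 5) * C $$ (5, 4) = 1"
    using along[of "transpose 0 1 \<circ> transpose 1 3 \<circ> transpose 3 2 \<circ> transpose 4 5"]
    by (simp add: perm_simps minus_equation_iff)
  have e3: "C $$ (0, 2) * C $$ (1, 0) * C $$ (2, 1) * C $$ (3, 5) * C $$ (4, 3) * C $$ (5, 4) = 1"
    using along[of "transpose 0 2 \<circ> transpose 2 1 \<circ> transpose 3 5 \<circ> transpose 5 4"]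
    by (simp add: perm_simps minus_equation_iff)
  have f1: "C $$ (0, 1) * C $$ (1, 0) * C $$ (2, 5) * C $$ (3, 2) * C $$ (4, 3) * C $$ (5, 4) = 1"
    using along[of "transpose 0 1 \<circ> transpose 2 5 \<circ> transpose 5 4 \<circ> transpose 4 3"]
    by (simp add: perm_simps minus_equation_iff)
  \<comment> \<open>This 6-cycle is the only odd permutation of the six.\<close>
  have f2: "C $$ (0, 1) * C $$ (1, 3) * C $$ (2, 0) * C $$ (3, 5) * C $$ (4, 2) * C $$ (5, 4) = -1"
    using along[of "transpose 0 1 \<circ> transpose 1 3 \<circ> transpose 3 5 \<circ> transpose 5 4 \<circ> transpose 4 2"]
    by (simp add: perm_simps minus_equation_iff)
  have f3: "C $$ (0, 2) * C $$ (1, 0) * C $$ (2, 1) * C $$ (3, 4) * C $$ (4, 5) * C $$ (5, 3) = 1"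
    using along[of "transpose 0 2 \<circ> transpose 2 1 \<circ> transpose 3 4 \<circ> transpose 4 5"]
    by (simp add: perm_simps minus_equation_iff)
  \<comment> \<open>Both sides use the same positions with multiplicity: (0, 1), (1, 0) and (5, 4)
    twice, twelve others once. The known values turn the equation into
    \<open>1 = -1\<close>.\<close>
  have "(C $$ (0, 1) * C $$ (1, 0) * C $$ (2, 5) * C $$ (3, 4) * C $$ (4, 2) * C $$ (5, 3)) *
      (C $$ (0, 1) * C $$ (1, 3) * C $$ (2, 0) * C $$ (3, 2) * C $$ (4, 5) * C $$ (5, 4)) *
      (C $$ (0, 2) * C $$ (1, 0) * C $$ (2, 1) * C $$ (3, 5) * C $$ (4, 3) * C $$ (5, 4)) =
      (C $$ (0, 1) * C $$ (1, 0) * C $$ (2, 5) * C $$ (3, 2) * C $$ (4, 3) * C $$ (5, 4)) *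
      (C $$ (0, 1) * C $$ (1, 3) * C $$ (2, 0) * C $$ (3, 5) * C $$ (4, 2) * C $$ (5, 4)) *
      (C $$ (0, 2) * C $$ (1, 0) * C $$ (2, 1) * C $$ (3, 4) * C $$ (4, 5) * C $$ (5, 3))"
    by (simp only: mult_ac)
  then show False
    unfolding e1 e2 e3 f1 f2 f3 by simp
qed

section \<open>Both directions of the characterization\<close>

theorem theorem4p13:
  fixes l u :: nat
  assumes "l \<ge> 1" and "u \<ge> 1"
  shows "((\<forall>n. \<exists>C. is_multiplier l u n C) \<longleftrightarrow> (min l u = 1 \<or> (l, u) = (2, 2))) \<and>
         ((min l u = 1 \<or> (l, u) = (2, 2)) \<longrightarrow>
           (\<exists>c :: nat \<Rightarrow> nat \<Rightarrow> complex.
              (\<forall>i j. int j - int i \<in> offsets l u \<longrightarrow> c i j \<in> {1, -1}) \<and>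
              (\<forall>n. is_multiplier l u n (mat n n (\<lambda>(i, j). c i j)))))"
proof -
  have pos: "\<exists>c :: nat \<Rightarrow> nat \<Rightarrow> complex.
      (\<forall>i j. int j - int i \<in> offsets l u \<longrightarrow> c i j \<in> {1, -1}) \<and>
      (\<forall>n. is_multiplier l u n (mat n n (\<lambda>(i, j). c i j)))"
    if lu: "min l u = 1 \<or> (l, u) = (2, 2)"
  proof (cases "l = 1 \<or> l = 2 \<and> u = 2")
    case True
    then show ?thesis
      using is_multiplier_subdiag_sign
      by (intro exI[of _ subdiag_sign]) (auto simp: subdiag_sign_def)
  next
    case False
    then have "u = 1"
      using lu by (auto simp: min_def split: if_splits)
    \<comment> \<open>For \<open>u = 1\<close> the signs move to the first superdiagonal.\<close>
    have "mat n n (\<lambda>(i, j). subdiag_sign j i) =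
        transpose_mat (mat n n (\<lambda>(i, j). subdiag_sign i j))" for n
      by (intro eq_matI) auto
    then have "is_multiplier l u n (mat n n (\<lambda>(i, j). subdiag_sign j i))" for n
      using is_multiplier_transpose[OF is_multiplier_subdiag_sign] \<open>u = 1\<close> by simp
    then show ?thesis
      by (intro exI[of _ "\<lambda>i j. subdiag_sign j i"]) (auto simp: subdiag_sign_def)
  qed
  have neg: "min l u = 1 \<or> (l, u) = (2, 2)" if mult: "\<forall>n. \<exists>C. is_multiplier l u n C"
  proof (rule ccontr)
    assume "\<not> ?thesis"
    \<comment> \<open>Both parameters are at least 2 and not both equal to 2; the second alternative
      becomes the first after transposing.\<close>
    then have "2 \<le> l \<and> 3 \<le> u \<or> 2 \<le> u \<and> 3 \<le> l"
      using assms by (auto simp: min_def split: if_splits)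
    then show False
      using mult not_is_multiplier_6 is_multiplier_transpose by blast
  qed
  show ?thesis
    using pos neg by blast
qed

end
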